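(* Let $u,v \in \mathbb{N}^*$. Let $A_1,\dots,A_k$ be all the intervals of $\mathrm{supp}(u)$ such that $A_i$ only contains simple letters of $u$ and $A_i \cup \{a\}$ is not an interval of $\mathrm{supp}(u)$ for any simple letter $a \notin A_i$ of $u$. Then $u \equiv_{\mathrm{jTg}} v$ if and only if $\mathrm{cont}(u) = \mathrm{cont}(v)$ and $u[A_i] \equiv_{\mathrm{hypo}} v[A_i]$ for all $1 \leq i \leq k$.
   Context: $\mathbb{N}=\{1,2,\dots\}$ with its usual order and $\mathbb{N}^*$ is the free monoid of words over $\mathbb{N}$. For a word $w$: $|w|_x$ is the number of occurrences of $x$ in $w$; $\mathrm{cont}(w)$ is the function $x\mapsto|w|_x$; $\mathrm{supp}(w)$ is the set of letters occurring in $w$; a letter $x$ is simple in $w$ if $|w|_x=1$; for a set $S$ of letters, $w[S]$ is the word obtained from $w$ by deleting all letters not in $S$. An interval of $\mathrm{supp}(u)$ is a (nonempty) set of consecutive elements of the finite totally ordered set $\mathrm{supp}(u)$; thus the $A_i$ are the maximal intervals of $\mathrm{supp}(u)$ consisting of simple letters. Define the following sets of pairs (with $a,b,c\in\mathbb{N}$, $w\in\mathbb{N}^*$): $\mathcal{R}_{\mathrm{sylv}}=\{(ca\,w\,b,\ ac\,w\,b): a\le b<c\}$, $\mathcal{R}_{\mathrm{sylv}^\#}=\{(b\,w\,ac,\ b\,w\,ca): a<b\le c\}$, $\mathcal{R}_{\mathrm{rSt}}=\{(ba\,w\,b,\ ab\,w\,b)\}$, $\mathcal{R}_{\mathrm{lSt}}=\{(b\,w\,ab,\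 b\,w\,ba)\}$. The hypoplactic congruence $\equiv_{\mathrm{hypo}}$ is the congruence on $\mathbb{N}^*$ generated by $\mathcal{R}_{\mathrm{sylv}}\cup\mathcal{R}_{\mathrm{sylv}^\#}$. The right-taiga congruence is generated by $\mathcal{R}_{\mathrm{sylv}}\cup\mathcal{R}_{\mathrm{rSt}}$ and the left-taiga congruence by $\mathcal{R}_{\mathrm{sylv}^\#}\cup\mathcal{R}_{\mathrm{lSt}}$. The join-taiga congruence $\equiv_{\mathrm{jTg}}$ is the join of the right-taiga and left-taiga congruences, i.e. the congruence generated by the union of all four sets. *)

theory Defs
  imports Main
begin

text \<open>Words over the positive integers are lists of natural numbers from \<open>lists {1..}\<close>; the monoid
  operation is \<open>@\<close>.\<close>

type_synonym word = "nat list"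

definition Nstar :: "word set" where
  "Nstar = lists {1..}"

definition cont :: "word \<Rightarrow> nat \<Rightarrow> nat" where
  "cont w = (\<lambda>x. count_list w x)"

abbreviation supp :: "word \<Rightarrow> nat set" where
  "supp w \<equiv> set w"

definition simple_letter :: "word \<Rightarrow> nat \<Rightarrow> bool" where
  "simple_letter w x \<longleftrightarrow> count_list w x = 1"

definition restrict_word :: "word \<Rightarrow> nat set \<Rightarrow> word" where
  "restrict_word w S = filter (\<lambda>x. x \<in> S) w"

definition is_interval :: "nat set \<Rightarrow> nat set \<Rightarrow> bool" where
  "is_interval S I \<longleftrightarrow>
     I \<noteq> {} \<and> I \<subseteq> S \<and> (\<forall>x\<in>I. \<forall>y\<in>I. \<forall>z\<in>S. x \<le> z \<and> z \<le> y \<longrightarrow> z \<in> I)"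

definition simple_intervals :: "word \<Rightarrow> nat set set" where
  "simple_intervals u =
     {A. is_interval (supp u) A \<and> (\<forall>x\<in>A. simple_letter u x) \<and>
         (\<forall>a. simple_letter u a \<and> a \<notin> A \<longrightarrow> \<not> is_interval (supp u) (A \<union> {a}))}"

definition R_sylv :: "(word \<times> word) set" where
  "R_sylv = {([c, a] @ w @ [b], [a, c] @ w @ [b]) | a b c w.
     a \<in> {1..} \<and> b \<in> {1..} \<and> c \<in> {1..} \<and> w \<in> Nstar \<and> a \<le> b \<and> b < c}"

definition R_sylv_sharp :: "(word \<times> word) set" where
  "R_sylv_sharp = {([b] @ w @ [a, c], [b] @ w @ [c, a]) | a b c w.
     a \<in> {1..} \<and> b \<in> {1..} \<and> c \<in> {1..} \<and> w \<in> Nstar \<and> a < b \<and> b \<le> c}"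

definition R_rSt :: "(word \<times> word) set" where
  "R_rSt = {([b, a] @ w @ [b], [a, b] @ w @ [b]) | a b w.
     a \<in> {1..} \<and> b \<in> {1..} \<and> w \<in> Nstar}"

definition R_lSt :: "(word \<times> word) set" where
  "R_lSt = {([b] @ w @ [a, b], [b] @ w @ [b, a]) | a b w.
     a \<in> {1..} \<and> b \<in> {1..} \<and> w \<in> Nstar}"

text \<open>The least congruence of the monoid \<open>Nstar\<close> containing \<open>R\<close>, for \<open>R \<subseteq> Nstar \<times> Nstar\<close>. Reflexivity
  is asserted on \<open>Nstar\<close> only, so that no other lists are related.\<close>

inductive_set congruence_gen :: "(word \<times> word) set \<Rightarrow> (word \<times> word) set"
  for R :: "(word \<times> word) set" where
  base: "(u, v) \<in> R \<Longrightarrow> (u, v) \<in> congruence_gen R"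
| refl: "u \<in> Nstar \<Longrightarrow> (u, u) \<in> congruence_gen R"
| sym: "(u, v) \<in> congruence_gen R \<Longrightarrow> (v, u) \<in> congruence_gen R"
| trans: "(u, v) \<in> congruence_gen R \<Longrightarrow> (v, w) \<in> congruence_gen R \<Longrightarrow> (u, w) \<in> congruence_gen R"
| mult: "(u, v) \<in> congruence_gen R \<Longrightarrow> (x, y) \<in> congruence_gen R \<Longrightarrow>
    (u @ x, v @ y) \<in> congruence_gen R"

definition hypo :: "(word \<times> word) set" where
  "hypo = congruence_gen (R_sylv \<union> R_sylv_sharp)"

definition right_taiga :: "(word \<times> word) set" where
  "right_taiga = congruence_gen (R_sylv \<union> R_rSt)"

definition left_taiga :: "(word \<times> word) set" where
  "left_taiga = congruence_gen (R_sylv_sharp \<union> R_lSt)"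

definition join_taiga :: "(word \<times> word) set" where
  "join_taiga = congruence_gen (right_taiga \<union> left_taiga)"

lemma congruence_gen_least:
  assumes "(u, v) \<in> congruence_gen R" and "R \<subseteq> congruence_gen S"
  shows "(u, v) \<in> congruence_gen S"
  using assms(1) by induction (use assms(2) in \<open>blast intro: congruence_gen.intros\<close>)+

lemma join_taiga_eq:
  "join_taiga = congruence_gen (R_sylv \<union> R_sylv_sharp \<union> R_rSt \<union> R_lSt)" (is "_ = ?C")
proof
  have "right_taiga \<union> left_taiga \<subseteq> ?C"
    unfolding right_taiga_def left_taiga_def
    by (auto elim!: congruence_gen_least intro: congruence_gen.base)
  then show "join_taiga \<subseteq> ?C"
    unfolding join_taiga_def by (auto elim: congruence_gen_least)
  have "R_sylv \<union> R_sylv_sharp \<union> R_rSt \<union> R_lSt \<subseteq> join_taiga"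
    unfolding join_taiga_def right_taiga_def left_taiga_def
    by (auto intro!: congruence_gen.base)
  then show "?C \<subseteq> join_taiga"
    unfolding join_taiga_def by (auto elim: congruence_gen_least)
qed

end

theory Submission
  imports Defs
begin

text \<open>In a join-taiga class, two adjacent letters \<open>x < y\<close> may be exchanged as soon as some other
  position of the word carries a letter of \<open>{x..y}\<close>, that is, unless \<open>x\<close> and \<open>y\<close> are simple and
  consecutive in the support. This condition depends on the content only, so on words of a fixed
  content the congruence is a partial commutation, and two words are congruent iff their
  projections onto all pairs of non-commuting letters agree. On words whose letters are all simple,
  the hypoplactic congruence is the same partial commutation, and a pair of simple consecutive
  letters of \<open>u\<close> lies in a common maximal interval of simple letters.\<close>

section \<open>Linked pairs, content and restriction\<close>

text \<open>Absent letters are allowed, so that linkedness in a product passes to its factors.\<close>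

definition linked :: "word \<Rightarrow> nat \<Rightarrow> nat \<Rightarrow> bool" where
  "linked w x y \<longleftrightarrow> x < y \<and> count_list w x \<le> 1 \<and> count_list w y \<le> 1 \<and>
     (\<forall>z\<in>set w. \<not> (x < z \<and> z < y))"

lemma linked_appendD:
  assumes "linked (u @ v) x y"
  shows "linked u x y" "linked v x y"
  using assms by (auto simp: linked_def)

lemma set_eq_if_cont_eq: "cont u = cont v \<Longrightarrow> set u = set v"
  by (auto simp: cont_def fun_eq_iff) (metis count_list_0_iff)+

lemma linked_cong:
  assumes "cont u = cont v"
  shows "linked u = linked v"
proof -
  have "count_list u = count_list v" using assms by (simp add: cont_def)
  then show ?thesis using set_eq_if_cont_eq[OF assms] by (intro ext) (simp only: linked_def)
qed

lemma Nstar_append [simp]: "u @ v \<in> Nstar \<longleftrightarrow> u \<in> Nstar \<and> v \<in> Nstar"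
  by (auto simp: Nstar_def)

lemma Nstar_Cons [simp]: "x # v \<in> Nstar \<longleftrightarrow> 1 \<le> x \<and> v \<in> Nstar"
  by (auto simp: Nstar_def)

lemma Nstar_restrict: "u \<in> Nstar \<Longrightarrow> restrict_word u S \<in> Nstar"
  by (auto simp: Nstar_def restrict_word_def)

lemma Nstar_cong: "cont u = cont v \<Longrightarrow> u \<in> Nstar \<longleftrightarrow> v \<in> Nstar"
  by (drule set_eq_if_cont_eq) (simp add: Nstar_def in_lists_conv_set)

lemma cont_restrict_word: "cont (restrict_word w S) x = (if x \<in> S then cont w x else 0)"
  by (induction w) (simp_all add: cont_def restrict_word_def)

lemma restrict_restrict_word: "restrict_word (restrict_word w S) T = restrict_word w (S \<inter> T)"
  by (simp add: restrict_word_def)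

section \<open>Invariants of the join-taiga congruence\<close>

text \<open>If the projection changed, \<open>x\<close> and \<open>y\<close> would be
  \<open>i\<close> and \<open>j\<close> in some order, forcing \<open>z\<close> into the range from
  \<open>i\<close> to \<open>j\<close>. No letter of the word lies strictly between these, so
  \<open>z\<close> would be a second copy of \<open>i\<close> or \<open>j\<close>, while each occurs
  at most once.\<close>

lemma restrict_swap_eq_if_linked:
  assumes "linked (p @ [x, y] @ s) i j" and "z \<in> set p \<union> set s"
    and "x \<le> z \<and> z \<le> y \<or> y \<le> z \<and> z \<le> x"
  shows "restrict_word (p @ [x, y] @ s) {i, j} = restrict_word (p @ [y, x] @ s) {i, j}"
proof (cases "x = y")
  case False
  have "\<not> (x \<in> {i, j} \<and> y \<in> {i, j})"
  proof
    assume "x \<in> {i, j} \<and> y \<in> {i, j}"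
    then have ij: "x = i \<and> y = j \<or> x = j \<and> y = i"
      using False by blast
    have "count_list p z + count_list s z \<noteq> 0"
      using assms(2) by (auto simp: count_list_0_iff)
    moreover have le: "count_list (p @ [x, y] @ s) i \<le> 1" "count_list (p @ [x, y] @ s) j \<le> 1"
      and lt: "i < j" and gap: "\<not> (i < z \<and> z < j)"
      using assms(1,2) by (auto simp: linked_def)
    ultimately have "z \<noteq> i" "z \<noteq> j"
      using ij False by (auto split: if_splits)
    moreover have "i \<le> z \<and> z \<le> j"
      using ij lt assms(3) by linarith
    ultimately show False
      using gap by simp
  qed
  then show ?thesis
    by (auto simp: restrict_word_def)
qed simp

text \<open>All four families of generators exchange two adjacent letters while a third position
  carries a letter weakly between them. Linkedness depends on the content only, which carries the
  claim through symmetry and transitivity.\<close>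

lemma join_taiga_invariant:
  assumes "(u, v) \<in> join_taiga"
  shows "cont u = cont v \<and>
    (\<forall>i j. linked u i j \<longrightarrow> restrict_word u {i, j} = restrict_word v {i, j})"
  using assms unfolding join_taiga_eq
proof induction
  case (base u v)
  then obtain p x y s z where "u = p @ [x, y] @ s" "v = p @ [y, x] @ s"
    "z \<in> set p \<union> set s" "x \<le> z \<and> z \<le> y \<or> y \<le> z \<and> z \<le> x"
  proof (elim UnE)
    assume "(u, v) \<in> R_sylv"
    then obtain a b c w where "u = [c, a] @ w @ [b]" "v = [a, c] @ w @ [b]" "a \<le> b" "b < c"
      by (auto simp: R_sylv_def)
    then show ?thesis by (intro that[of "[]" c a "w @ [b]" b]) auto
  next
    assume "(u, v) \<in> R_sylv_sharp"
    then obtain a b c w where "u = [b] @ w @ [a, c]" "v = [b] @ w @ [c, a]" "a < b" "b \<le> c"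
      by (auto simp: R_sylv_sharp_def)
    then show ?thesis by (intro that[of "[b] @ w" a c "[]" b]) auto
  next
    assume "(u, v) \<in> R_rSt"
    then obtain a b w where "u = [b, a] @ w @ [b]" "v = [a, b] @ w @ [b]"
      by (auto simp: R_rSt_def)
    then show ?thesis by (intro that[of "[]" b a "w @ [b]" b]) auto
  next
    assume "(u, v) \<in> R_lSt"
    then obtain a b w where "u = [b] @ w @ [a, b]" "v = [b] @ w @ [b, a]"
      by (auto simp: R_lSt_def)
    then show ?thesis by (intro that[of "[b] @ w" a b "[]" b]) auto
  qed
  then show ?case
    using restrict_swap_eq_if_linked[of p x y s _ _ z] by (simp add: cont_def fun_eq_iff)
next
  case (sym u v)
  then show ?case using linked_cong[of u v] by auto
next
  case (trans u v w)
  then show ?case using linked_cong[of u v] by auto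
next
  case (mult u v x y)
  then have "cont (u @ x) = cont (v @ y)" by (simp add: cont_def fun_eq_iff)
  moreover have "restrict_word (u @ x) {i, j} = restrict_word (v @ y) {i, j}"
    if "linked (u @ x) i j" for i j
    using mult.IH linked_appendD[OF that] by (simp add: restrict_word_def)
  ultimately show ?case by blast
qed simp

section \<open>Exchanges of adjacent letters\<close>

lemma hypo_subset_join_taiga: "hypo \<subseteq> join_taiga"
  unfolding hypo_def join_taiga_eq
  by (auto elim!: congruence_gen_least intro: congruence_gen.base)

lemma congruence_gen_context:
  assumes "(u, v) \<in> R" and "p \<in> Nstar" and "s \<in> Nstar"
  shows "(p @ u @ s, p @ v @ s) \<in> congruence_gen R"
  using assms by (intro congruence_gen.mult) (auto intro: congruence_gen.intros)

text \<open>A witness \<open>z\<close> on the left calls for \<open>R_sylv_sharp\<close>, one on the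
  right for \<open>R_sylv\<close>; strictness on both sides of \<open>z\<close> meets the bounds of
  either family.\<close>

lemma hypo_swap:
  assumes "p @ [x, y] @ s \<in> Nstar" and "z \<in> set p \<union> set s" and "x < z" and "z < y"
  shows "(p @ [x, y] @ s, p @ [y, x] @ s) \<in> hypo"
  using assms(2)
proof
  assume "z \<in> set p"
  then obtain p1 p2 where p: "p = p1 @ z # p2" by (meson split_list)
  have "([z] @ p2 @ [x, y], [z] @ p2 @ [y, x]) \<in> R_sylv_sharp"
    using assms p by (fastforce simp: R_sylv_sharp_def)
  from congruence_gen_context[OF UnI2[OF this], of p1 s] show ?thesis
    using assms p by (simp add: hypo_def)
next
  assume "z \<in> set s"
  then obtain s1 s2 where s: "s = s1 @ z # s2" by (meson split_list)
  have "([y, x] @ s1 @ [z], [x, y] @ s1 @ [z]) \<in> R_sylv"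
    using assms s by (fastforce simp: R_sylv_def)
  from congruence_gen_context[OF UnI1[OF this], of p s2] show ?thesis
    using assms s by (simp add: hypo_def congruence_gen.sym)
qed

text \<open>The case of strict inequalities is \<open>hypo_swap\<close>. A witness equal to
  \<open>x\<close> or \<open>y\<close> is handled by \<open>R_lSt\<close> when it stands to the left
  and by \<open>R_rSt\<close> when it stands to the right.\<close>

lemma join_taiga_swap:
  assumes "p @ [x, y] @ s \<in> Nstar" and "z \<in> set p \<union> set s" and "x \<le> z" and "z \<le> y"
  shows "(p @ [x, y] @ s, p @ [y, x] @ s) \<in> join_taiga"
proof -
  consider "x < z" "z < y" | "z = x" | "z = y" using assms by linarith
  then show ?thesis
  proof cases
    case 1
    then show ?thesis using hypo_swap hypo_subset_join_taiga assms by blast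
  next
    case z: 2
    from assms(2) show ?thesis
    proof
      assume "z \<in> set p"
      then obtain p1 p2 where p: "p = p1 @ z # p2" by (meson split_list)
      have "([z] @ p2 @ [y, x], [z] @ p2 @ [x, y]) \<in> R_lSt"
        using assms p z by (fastforce simp: R_lSt_def)
      from congruence_gen_context[OF UnI2[OF this], of p1 s] show ?thesis
        using assms p by (simp add: join_taiga_eq congruence_gen.sym)
    next
      assume "z \<in> set s"
      then obtain s1 s2 where s: "s = s1 @ z # s2" by (meson split_list)
      have "([x, y] @ s1 @ [z], [y, x] @ s1 @ [z]) \<in> R_rSt"
        using assms s z by (fastforce simp: R_rSt_def)
      from congruence_gen_context[OF UnI1[OF UnI2[OF this]], of p s2] show ?thesis
        using assms s by (simp add: join_taiga_eq)
    qed
  next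
    case z: 3
    from assms(2) show ?thesis
    proof
      assume "z \<in> set p"
      then obtain p1 p2 where p: "p = p1 @ z # p2" by (meson split_list)
      have "([z] @ p2 @ [x, y], [z] @ p2 @ [y, x]) \<in> R_lSt"
        using assms p z by (fastforce simp: R_lSt_def)
      from congruence_gen_context[OF UnI2[OF this], of p1 s] show ?thesis
        using assms p by (simp add: join_taiga_eq)
    next
      assume "z \<in> set s"
      then obtain s1 s2 where s: "s = s1 @ z # s2" by (meson split_list)
      have "([y, x] @ s1 @ [z], [x, y] @ s1 @ [z]) \<in> R_rSt"
        using assms s z by (fastforce simp: R_rSt_def)
      from congruence_gen_context[OF UnI1[OF UnI2[OF this]], of p s2] show ?thesis
        using assms s by (simp add: join_taiga_eq congruence_gen.sym)
    qed
  qed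
qed

section \<open>Projection criterion for partial commutations\<close>

text \<open>Read \<open>D x y\<close> (for \<open>x < y\<close>) as: \<open>x\<close> and \<open>y\<close> do not commute. The prefix \<open>p\<close> keeps the content of the ambient word fixed, since it governs
  which swaps are available.\<close>

lemma partial_commutation_projection:
  assumes "trans C" and "sym C"
    and refl: "\<And>w. cont w = m \<Longrightarrow> (w, w) \<in> C"
    and swap: "\<And>p x y s. \<lbrakk>cont (p @ [x, y] @ s) = m; x < y; \<not> D x y\<rbrakk> \<Longrightarrow>
      (p @ [x, y] @ s, p @ [y, x] @ s) \<in> C"
    and "cont (p @ u) = m" and "cont u = cont v"
    and "\<And>x y. \<lbrakk>x \<in> set u; y \<in> set u; x < y; D x y\<rbrakk> \<Longrightarrow>
      restrict_word u {x, y} = restrict_word v {x, y}"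
  shows "(p @ u, p @ v) \<in> C"
  using assms(5-)
proof (induction u arbitrary: p v)
  case Nil
  then have "v = []" using set_eq_if_cont_eq[of "[]" v] by simp
  then show ?case using Nil refl by simp
next
  case (Cons a u)
  have set_eq: "set (a # u) = set v" using Cons.prems set_eq_if_cont_eq by blast
  \<comment> \<open>Splitting \<open>v\<close> at its first \<open>a\<close> reduces the task to
    moving this \<open>a\<close> leftwards across \<open>v1\<close> and then matching the
    remainders.\<close>
  then obtain v1 v2 where v: "v = v1 @ a # v2" and a: "a \<notin> set v1"
    by (metis list.set_intros(1) split_list_first)
  have swap': "(q @ [b, a] @ s, q @ [a, b] @ s) \<in> C"
    if "b \<in> set v1" "cont (q @ [b, a] @ s) = m" for b q s
  proof -
    \<comment> \<open>The two projections differ in their first letter: that of \<open>a # u\<close>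
      starts with \<open>a\<close>, that of \<open>v\<close> with a letter of \<open>v1\<close>.
      Hence \<open>a\<close> and \<open>b\<close> commute.\<close>
    have first: "restrict_word (a # u) {a, b} \<noteq> restrict_word v {a, b}"
    proof
      assume "restrict_word (a # u) {a, b} = restrict_word v {a, b}"
      then have eq: "a # filter (\<lambda>x. x \<in> {a, b}) u =
          filter (\<lambda>x. x \<in> {a, b}) v1 @ filter (\<lambda>x. x \<in> {a, b}) (a # v2)"
        by (simp add: restrict_word_def v)
      have "b \<in> set (filter (\<lambda>x. x \<in> {a, b}) v1)" using that by simp
      then obtain c l where c: "filter (\<lambda>x. x \<in> {a, b}) v1 = c # l"
        by (metis in_set_conv_decomp list.exhaust append_is_Nil_conv list.distinct(1))
      then have "c \<in> set (filter (\<lambda>x. x \<in> {a, b}) v1)" by simp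
      moreover have "c = a" using eq c by simp
      ultimately show False using a by simp
    qed
    have mem: "a \<in> set (a # u)" "b \<in> set (a # u)"
      using set_eq that v by auto
    have "a < b \<or> b < a" using that a by (metis linorder_neqE_nat)
    then show ?thesis
    proof
      assume "a < b"
      moreover from this have "\<not> D a b" using first Cons.prems(3)[of a b] mem by blast
      moreover have "cont (q @ [a, b] @ s) = cont (q @ [b, a] @ s)"
        by (simp add: cont_def fun_eq_iff)
      ultimately show ?thesis using swap that \<open>sym C\<close> by (metis symD)
    next
      assume "b < a"
      moreover from this have "\<not> D b a"
        using first Cons.prems(3)[of b a] mem by (auto simp: insert_commute)
      ultimately show ?thesis using swap that by blast
    qed
  qed
  have m: "cont (p @ v) = m"
    using Cons.prems by (auto simp: cont_def fun_eq_iff)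
  have "(p @ v1 @ a # s, p @ a # v1 @ s) \<in> C" if "cont (p @ v1 @ a # s) = m" for s
    using that a swap'
  \<comment> \<open>The letter next to \<open>a\<close> is the last one of \<open>v1\<close>, so
    \<open>v1\<close> is consumed from its right end.\<close>
  proof (induction v1 arbitrary: s rule: rev_induct)
    case Nil
    then show ?case using refl by simp
  next
    case (snoc b v1)
    have "((p @ v1) @ [b, a] @ s, (p @ v1) @ [a, b] @ s) \<in> C"
      using snoc.prems(1) by (intro snoc.prems(3)) simp_all
    moreover have "(p @ v1 @ a # b # s, p @ a # v1 @ b # s) \<in> C"
    proof (rule snoc.IH)
      have "cont (p @ v1 @ a # b # s) = cont (p @ (v1 @ [b]) @ a # s)"
        by (simp add: cont_def fun_eq_iff)
      then show "cont (p @ v1 @ a # b # s) = m" using snoc.prems(1) by simp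
      show "(q @ [c, a] @ t, q @ [a, c] @ t) \<in> C"
        if "c \<in> set v1" "cont (q @ [c, a] @ t) = m" for c q t
        using that by (intro snoc.prems(3)) simp_all
    qed (use snoc.prems(2) in simp)
    ultimately show ?case using \<open>trans C\<close> by (auto dest: transD)
  qed
  from this[of v2] have "(p @ a # v1 @ v2, p @ v) \<in> C"
    using m v \<open>sym C\<close> by (auto dest: symD)
  \<comment> \<open>The matched \<open>a\<close> joins the prefix, so the ambient content stays
    \<open>m\<close>.\<close>
  moreover have "((p @ [a]) @ u, (p @ [a]) @ v1 @ v2) \<in> C"
  proof (rule Cons.IH)
    show "cont u = cont (v1 @ v2)"
      using Cons.prems(2) unfolding v by (auto simp: cont_def fun_eq_iff split: if_splits)
    fix x y assume xy: "x \<in> set u" "y \<in> set u" "x < y" "D x y"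
    then have "restrict_word (a # u) {x, y} = restrict_word v {x, y}"
      using Cons.prems(3) by auto
    \<comment> \<open>Equal projections both start with \<open>a\<close> here, and \<open>v1\<close>
      has no \<open>a\<close>, so it contributes nothing. Cancelling \<open>a\<close> thus removes
      the head on both sides.\<close>
    moreover have "filter (\<lambda>z. z \<in> {x, y}) v1 = []" if "a \<in> {x, y}"
    proof (rule ccontr)
      assume ne: "filter (\<lambda>z. z \<in> {x, y}) v1 \<noteq> []"
      then have "hd (filter (\<lambda>z. z \<in> {x, y}) v1) \<in> set v1"
        using hd_in_set[OF ne] by simp
      moreover have "hd (filter (\<lambda>z. z \<in> {x, y}) v1) = a"
        using calculation \<open>restrict_word (a # u) {x, y} = restrict_word v {x, y}\<close> that ne
        by (cases "filter (\<lambda>z. z \<in> {x, y}) v1") (auto simp: restrict_word_def v)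
      ultimately show False using a by simp
    qed
    ultimately show "restrict_word u {x, y} = restrict_word (v1 @ v2) {x, y}"
      unfolding restrict_word_def v by (cases "a \<in> {x, y}") auto
  qed (use Cons.prems in auto)
  ultimately show ?case using \<open>trans C\<close> by (auto dest: transD)
qed

section \<open>Projections determine the congruence classes\<close>

lemma trans_congruence_gen: "trans (congruence_gen R)"
  by (auto intro!: transI elim: congruence_gen.trans)

lemma sym_congruence_gen: "sym (congruence_gen R)"
  by (auto intro!: symI elim: congruence_gen.sym)

text \<open>Converse to \<open>join_taiga_invariant\<close>: an unlinked pair can be exchanged in
  every word with the content of \<open>u\<close>, so the projection criterion applies with
  \<open>D = linked u\<close>.\<close>

lemma join_taigaI:
  assumes "u \<in> Nstar" and "cont u = cont v"
    and "\<And>x y. \<lbrakk>x \<in> set u; y \<in> set u; linked u x y\<rbrakk> \<Longrightarrow>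
      restrict_word u {x, y} = restrict_word v {x, y}"
  shows "(u, v) \<in> join_taiga"
proof -
  have "([] @ u, [] @ v) \<in> join_taiga"
  proof (rule partial_commutation_projection[where m = "cont u" and D = "linked u"])
    show "trans join_taiga" "sym join_taiga"
      by (simp_all add: join_taiga_def trans_congruence_gen sym_congruence_gen)
    show "(w, w) \<in> join_taiga" if "cont w = cont u" for w
      using assms(1) Nstar_cong[OF that] by (simp add: join_taiga_def congruence_gen.refl)
    fix p x y s assume *: "cont (p @ [x, y] @ s) = cont u" "x < y" "\<not> linked u x y"
    then have "\<not> linked (p @ [x, y] @ s) x y" using linked_cong[OF *(1)] by simp
    then obtain z where "z \<in> set p \<union> set s" "x \<le> z" "z \<le> y"
    proof -
      \<comment> \<open>A further copy of \<open>x\<close> or \<open>y\<close> is itself a witness.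
        Otherwise both occur once, and linkedness can fail only through a letter strictly
        between.\<close>
      consider "x \<in> set p \<union> set s" | "y \<in> set p \<union> set s" | "count_list p x = 0" "count_list s x = 0"
        "count_list p y = 0" "count_list s y = 0"
        by (auto simp: count_list_0_iff)
      then show ?thesis
      proof cases
        case 1
        then show ?thesis using that[of x] \<open>x < y\<close> by simp
      next
        case 2
        then show ?thesis using that[of y] \<open>x < y\<close> by simp
      next
        case 3
        then obtain z where "z \<in> set (p @ [x, y] @ s)" "x < z" "z < y"
          using \<open>\<not> linked (p @ [x, y] @ s) x y\<close> \<open>x < y\<close> by (auto simp: linked_def)
        then show ?thesis using that[of z] by auto
      qed
    qed
    then show "(p @ [x, y] @ s, p @ [y, x] @ s) \<in> join_taiga"
      using join_taiga_swap assms(1) Nstar_cong[OF *(1)] by blast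
  qed (use assms(2,3) in simp_all)
  then show ?thesis by simp
qed

text \<open>With no repeated letters, a pair \<open>x < y\<close> fails to be linked only through a
  letter strictly between, which is the witness that \<open>hypo_swap\<close> requires.\<close>

lemma hypoI:
  assumes "u \<in> Nstar" and "cont u = cont v" and simple: "\<And>x. count_list u x \<le> 1"
    and "\<And>x y. \<lbrakk>x \<in> set u; y \<in> set u; linked u x y\<rbrakk> \<Longrightarrow>
      restrict_word u {x, y} = restrict_word v {x, y}"
  shows "(u, v) \<in> hypo"
proof -
  have "([] @ u, [] @ v) \<in> hypo"
  proof (rule partial_commutation_projection[where m = "cont u" and D = "linked u"])
    show "trans hypo" "sym hypo"
      by (simp_all add: hypo_def trans_congruence_gen sym_congruence_gen)
    show "(w, w) \<in> hypo" if "cont w = cont u" for w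
      using assms(1) Nstar_cong[OF that] by (simp add: hypo_def congruence_gen.refl)
    fix p x y s assume *: "cont (p @ [x, y] @ s) = cont u" "x < y" "\<not> linked u x y"
    then obtain z where z: "z \<in> set u" "x < z" "z < y" using simple by (auto simp: linked_def)
    then have "z \<in> set p \<union> set s" using set_eq_if_cont_eq[OF *(1)] by auto
    then show "(p @ [x, y] @ s, p @ [y, x] @ s) \<in> hypo"
      using hypo_swap z assms(1) Nstar_cong[OF *(1)] by blast
  qed (use assms(2,4) in simp_all)
  then show ?thesis by simp
qed

section \<open>Maximal intervals of simple letters and the characterization\<close>

text \<open>Convexity of \<open>A\<close> ensures that restriction loses no letter of
  \<open>u\<close> between \<open>x\<close> and \<open>y\<close>.\<close>

lemma linked_restrict_interval:
  assumes "is_interval (set u) A" and "x \<in> A" and "y \<in> A"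
  shows "linked (restrict_word u A) x y \<longleftrightarrow> linked u x y"
proof -
  have "count_list (restrict_word u A) z = count_list u z" if "z \<in> A" for z
    using cont_restrict_word[of u A z] that by (simp add: cont_def)
  moreover have "z \<in> A" if "z \<in> set u" "x < z" "z < y" for z
    using assms that unfolding is_interval_def by (meson less_imp_le)
  ultimately show ?thesis
    using assms(2,3) by (auto simp: linked_def restrict_word_def)
qed

text \<open>The maximal interval around \<open>x\<close> consists of the letters that can be reached from \<open>x\<close> without
  passing a letter that is not simple.\<close>

lemma ex_simple_interval:
  assumes "x \<in> set u" and "y \<in> set u" and "linked u x y"
  obtains A where "A \<in> simple_intervals u" and "x \<in> A" and "y \<in> A"
proof -
  define A where "A = {z \<in> set u. \<forall>t \<in> set u. min x z \<le> t \<and> t \<le> max x z \<longrightarrow> simple_letter u t}"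
  \<comment> \<open>\<open>linked\<close> tolerates absent letters; occurrence in \<open>u\<close>
    sharpens its bound on the counts to simplicity.\<close>
  have "count_list u x \<noteq> 0" "count_list u y \<noteq> 0" using assms by (auto simp: count_list_0_iff)
  then have simple: "simple_letter u x" "simple_letter u y" and "x < y"
    and between: "\<And>t. t \<in> set u \<Longrightarrow> x \<le> t \<Longrightarrow> t \<le> y \<Longrightarrow> t = x \<or> t = y"
    using assms by (auto simp: linked_def simple_letter_def order_le_less)
  have "x \<in> A" using simple assms by (auto simp: A_def)
  moreover have "y \<in> A" using simple assms between \<open>x < y\<close> by (auto simp: A_def)
  moreover have "A \<in> simple_intervals u"
    unfolding simple_intervals_def
  proof (intro CollectI conjI allI impI ballI)
    show "is_interval (set u) A"
      unfolding is_interval_def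
    proof (intro conjI ballI impI)
      fix i j k assume *: "i \<in> A" "j \<in> A" "k \<in> set u" "i \<le> k \<and> k \<le> j"
      have "simple_letter u t" if "t \<in> set u" "min x k \<le> t" "t \<le> max x k" for t
      \<comment> \<open>The segment from \<open>x\<close> to \<open>k\<close> lies inside the one
        from \<open>x\<close> to \<open>i\<close> or the one from \<open>x\<close> to
        \<open>j\<close>, according to the side of \<open>x\<close> on which \<open>k\<close>
        stands.\<close>
      proof (cases "k \<le> x")
        case True
        then have "min x i \<le> t" "t \<le> max x i" using *(4) that by linarith+
        then show ?thesis using *(1) that(1) by (simp add: A_def)
      next
        case False
        then have "min x j \<le> t" "t \<le> max x j" using *(4) that by linarith+
        then show ?thesis using *(2) that(1) by (simp add: A_def)
      qed
      then show "k \<in> A" using * by (auto simp: A_def)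
    qed (use \<open>x \<in> A\<close> in \<open>auto simp: A_def\<close>)
    show "simple_letter u z" if "z \<in> A" for z using that by (auto simp: A_def)
    show "\<not> is_interval (set u) (A \<union> {a})" if a: "simple_letter u a \<and> a \<notin> A" for a
    proof
      assume int: "is_interval (set u) (A \<union> {a})"
      \<comment> \<open>An interval containing \<open>x\<close> and \<open>a\<close> contains the
        whole segment between them. Its letters are then all simple, which would put
        \<open>a\<close> into \<open>A\<close>.\<close>
      have "simple_letter u t" if t: "t \<in> set u" "min x a \<le> t" "t \<le> max x a" for t
      proof -
        have "t \<in> A \<union> {a}"
          using int t \<open>x \<in> A\<close> unfolding is_interval_def
          by (metis UnI1 UnI2 insertI1 max_def min_def)
        then show ?thesis using a t by (auto simp: A_def)
      qed
      moreover have "a \<in> set u" using int by (auto simp: is_interval_def)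
      ultimately show False using a by (auto simp: A_def)
    qed
  qed
  ultimately show thesis using that by blast
qed

theorem proposition3p4:
  fixes u v :: word
  assumes "u \<in> Nstar" and "v \<in> Nstar"
  shows "(u, v) \<in> join_taiga \<longleftrightarrow>
    cont u = cont v \<and>
    (\<forall>A \<in> simple_intervals u. (restrict_word u A, restrict_word v A) \<in> hypo)"
proof (intro iffI conjI ballI)
  assume jt: "(u, v) \<in> join_taiga"
  then show cont_eq: "cont u = cont v" using join_taiga_invariant by blast
  fix A assume "A \<in> simple_intervals u"
  then have int: "is_interval (set u) A" and simple: "\<And>x. x \<in> A \<Longrightarrow> count_list u x = 1"
    by (auto simp: simple_intervals_def simple_letter_def)
  show "(restrict_word u A, restrict_word v A) \<in> hypo"
  proof (rule hypoI)
    show "restrict_word u A \<in> Nstar" using assms Nstar_restrict by blast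
    show "cont (restrict_word u A) = cont (restrict_word v A)"
      using cont_eq by (simp add: fun_eq_iff cont_restrict_word)
    show "count_list (restrict_word u A) x \<le> 1" for x
      using cont_restrict_word[of u A x] simple[of x] by (auto simp: cont_def split: if_splits)
    fix x y
    assume *: "x \<in> set (restrict_word u A)" "y \<in> set (restrict_word u A)"
      "linked (restrict_word u A) x y"
    then have A: "x \<in> A" "y \<in> A" by (auto simp: restrict_word_def)
    then have "restrict_word u {x, y} = restrict_word v {x, y}"
      using * jt join_taiga_invariant linked_restrict_interval[OF int A] by blast
    moreover have "A \<inter> {x, y} = {x, y}" using A by auto
    ultimately show "restrict_word (restrict_word u A) {x, y} =
        restrict_word (restrict_word v A) {x, y}"
      by (simp add: restrict_restrict_word)
  qed
next
  assume *: "cont u = cont v \<and>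
    (\<forall>A \<in> simple_intervals u. (restrict_word u A, restrict_word v A) \<in> hypo)"
  show "(u, v) \<in> join_taiga"
  \<comment> \<open>A linked pair of letters of \<open>u\<close> lies in a common \<open>A\<close>,
    so its projection is already visible in the restrictions to \<open>A\<close>. There the
    invariant applies, as \<open>hypo\<close> is contained in \<open>join_taiga\<close>.\<close>
  proof (rule join_taigaI)
    fix x y assume xy: "x \<in> set u" "y \<in> set u" "linked u x y"
    then obtain A where A: "A \<in> simple_intervals u" "x \<in> A" "y \<in> A"
      by (rule ex_simple_interval)
    then have "linked (restrict_word u A) x y"
      using xy linked_restrict_interval by (auto simp: simple_intervals_def)
    moreover have "(restrict_word u A, restrict_word v A) \<in> join_taiga"
      using * A hypo_subset_join_taiga by blast
    ultimately have "restrict_word (restrict_word u A) {x, y} =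
        restrict_word (restrict_word v A) {x, y}"
      using join_taiga_invariant by blast
    moreover have "A \<inter> {x, y} = {x, y}" using A by auto
    ultimately show "restrict_word u {x, y} = restrict_word v {x, y}"
      by (simp add: restrict_restrict_word)
  qed (use assms * in auto)
qed

end
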